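(* For any even prime power $q$, there exist the following pencil arcs in $\Pi_2(q^2)$: (i) a regular $(q+1,\,q)$-parc; (ii) a regular $((q+2)/2,\,2q)$-parc.
   Context: $\Pi_2(n)$ denotes the desarguesian projective plane over $GF(n)$. A pencil in $\Pi_2(n)$ is the set of all $n+1$ lines $\Psi_0,\ldots,\Psi_n$ through some common point. A $k$-parc (pencil arc) in $\Pi_2(n)$ with pencil $\Psi_0,\ldots,\Psi_n$ is a set $\mathcal{K}$ of $k$ points such that: (a) each $\mathcal{K}\cap\Psi_i$ is an $h_i$-arc in the projective line $\Psi_i$, where $h_i=|\mathcal{K}\cap\Psi_i|$ (i.e. any two of its points are independent, which is automatic); (b) $\mathcal{K}\cap\Psi_i\cap\Psi_j=\emptyset$ for $i\neq j$; (c) any three points of $\mathcal{K}$ not contained in any single $\Psi_i$ are linearly independent (non-collinear). A regular $(m,h)$-parc is a pencil arc for which, for a suitable labelling of the lines of the pencil, $h_0=h_1=\cdots=h_{m-1}=h$ and $h_m=\cdots=h_n=0$. *)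

theory Defs
  imports "HOL-Analysis.Cartesian_Space" "HOL-Number_Theory.Prime_Powers"
begin

text \<open>
  The desarguesian plane over a finite field \<open>'a\<close>: points are the one-dimensional subspaces of
  \<open>'a ^ 3\<close>; a line is the set of all points contained in a fixed two-dimensional subspace.
\<close>

definition proj_points :: "('a::{field,finite} ^ 3) set set" where
  "proj_points = {P. vec.subspace P \<and> vec.dim P = 1}"

definition proj_lines :: "('a::{field,finite} ^ 3) set set set" where
  "proj_lines = {{P \<in> proj_points. P \<subseteq> W} | W. vec.subspace W \<and> vec.dim W = 2}"

text \<open>
  Points are independent if vectors representing them are. The representatives of distinct points
  are distinct, so no injectivity condition on \<open>v\<close> is needed.
\<close>

definition independent_points :: "('a::{field,finite} ^ 3) set set \<Rightarrow> bool" where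
  "independent_points T \<longleftrightarrow>
     (\<exists>v. (\<forall>P\<in>T. P = vec.span {v P}) \<and> vec.independent (v ` T))"

definition line_arc :: "nat \<Rightarrow> ('a::{field,finite} ^ 3) set set \<Rightarrow> ('a ^ 3) set set \<Rightarrow> bool" where
  "line_arc h L A \<longleftrightarrow> L \<in> proj_lines \<and> A \<subseteq> L \<and> card A = h \<and>
     (\<forall>T\<subseteq>A. card T = 2 \<longrightarrow> independent_points T)"

text \<open>
  A pencil with a labelling of its lines by \<open>0, \<dots>, n\<close>, where \<open>n\<close> is the order of the field.
\<close>

definition labelled_pencil :: "(nat \<Rightarrow> ('a::{field,finite} ^ 3) set set) \<Rightarrow> bool" where
  "labelled_pencil \<Psi> \<longleftrightarrow>
     (\<exists>P\<in>proj_points. bij_betw \<Psi> {0..CARD('a)} {L \<in> proj_lines. P \<in> L})"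

definition parc ::
    "nat \<Rightarrow> (nat \<Rightarrow> ('a::{field,finite} ^ 3) set set) \<Rightarrow> ('a ^ 3) set set \<Rightarrow> bool" where
  "parc k \<Psi> K \<longleftrightarrow>
     labelled_pencil \<Psi> \<and> K \<subseteq> proj_points \<and> card K = k \<and>
     (\<forall>i\<le>CARD('a). line_arc (card (K \<inter> \<Psi> i)) (\<Psi> i) (K \<inter> \<Psi> i)) \<and>
     (\<forall>i\<le>CARD('a). \<forall>j\<le>CARD('a). i \<noteq> j \<longrightarrow> K \<inter> \<Psi> i \<inter> \<Psi> j = {}) \<and>
     (\<forall>T\<subseteq>K. card T = 3 \<and> \<not> (\<exists>i\<le>CARD('a). T \<subseteq> \<Psi> i) \<longrightarrow> independent_points T)"

definition regular_parc :: "nat \<Rightarrow> nat \<Rightarrow> ('a::{field,finite} ^ 3) set set \<Rightarrow> bool" where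
  "regular_parc m h K \<longleftrightarrow> m \<le> CARD('a) + 1 \<and>
     (\<exists>k \<Psi>. parc k \<Psi> K \<and>
        (\<forall>i<m. card (K \<inter> \<Psi> i) = h) \<and>
        (\<forall>i\<in>{m..CARD('a)}. card (K \<inter> \<Psi> i) = 0))"

end

theory Submission
  imports Defs "HOL-Analysis.Determinants" "HOL-Computational_Algebra.Polynomial"
begin

text \<open>
  Both pencil arcs are preimages of arcs of the plane over the subfield \<open>B\<close> with \<open>q\<close> elements.
  The trace \<open>tr x = x ^ q + x\<close> is \<open>B\<close>-linear from the field onto \<open>B\<close>, and all its fibres have
  \<open>q\<close> elements. Take an arc \<open>A\<close> over \<open>B\<close> that avoids the point \<open>(0, 0, 1)\<close>, and let \<open>K\<close> consist of
  the points \<open>(u, v, w)\<close> with \<open>u\<close>, \<open>v\<close> in \<open>B\<close> such that \<open>(u, v, tr w)\<close> is a point of \<open>A\<close>. The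
  pencil is that of all lines through the vertex \<open>(0, 0, 1)\<close>. If three points of \<open>K\<close> lie on
  different lines of the pencil, their determinant is linear in the \<open>w\<close>-coordinates with
  coefficients in \<open>B\<close>; its trace is therefore the determinant of three different points of \<open>A\<close>,
  which is nonzero. If two of the three points lie on one line of the pencil and the third does not,
  they are trivially independent. A line of the pencil that meets \<open>A\<close> in \<open>b\<close> points meets \<open>K\<close> in
  \<open>b * q\<close> points.

  For the first arc, \<open>A\<close> is a conic with nucleus \<open>(0, 0, 1)\<close>: each of the \<open>q + 1\<close> lines through the
  vertex in the plane over \<open>B\<close> is a tangent. For the second, \<open>A\<close> is a hyperoval, a
  conic together with its nucleus, that avoids the vertex: a line through the vertex meets it in \<open>0\<close> or \<open>2\<close> points, and \<open>(q + 2) / 2\<close>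
  lines meet it. A parameter \<open>e\<close> treats both cases at once, \<open>e = 0\<close> giving the conic and \<open>e = 1\<close>
  the hyperoval: \<open>A\<close> consists of the points \<open>(1, t\<^sup>2 + e * t, t)\<close> with \<open>t\<close> in \<open>B\<close> and of
  \<open>(0, 1, 0)\<close>, \<open>(0, 1, e)\<close>. Lemma \<open>regular_parcI\<close> reduces the claim to counting and to
  determinants, \<open>card_slice\<close> and \<open>card_slope_image\<close> do the counting, and \<open>det_affine_nonzero\<close>
  and \<open>det_infinite_nonzero\<close> treat the determinants.
\<close>

section \<open>The pencil through a point in homogeneous coordinates\<close>

text \<open>The vector that represents the common point of the lines of the pencil.\<close>

definition vertex :: "'a::{field,finite} ^ 3" where
  "vertex = vector [0, 0, 1]"

text \<open>
  The lines through the vertex are labelled by their slopes, where \<open>None\<close> stands for the infinite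
  slope. The vector \<open>rep s w\<close> represents the point with third coordinate \<open>w\<close> on the line with slope
  \<open>s\<close>. Its first nonzero coordinate is \<open>1\<close>, so that every point other than the vertex has exactly
  one representation of this form.
\<close>

definition rep :: "'a::{field,finite} option \<Rightarrow> 'a \<Rightarrow> 'a ^ 3" where
  "rep s w = (case s of None \<Rightarrow> vector [0, 1, w] | Some c \<Rightarrow> vector [1, c, w])"

text \<open>
  The subspace of dimension two that belongs to the line with slope \<open>s\<close> through the vertex.
\<close>

definition plane :: "'a::{field,finite} option \<Rightarrow> ('a ^ 3) set" where
  "plane s = {x. case s of None \<Rightarrow> x $ 1 = 0 | Some c \<Rightarrow> x $ 2 = c * x $ 1}"

text \<open>The line with slope \<open>s\<close> through the vertex, as a set of projective points.\<close>

definition pencil_line :: "'a::{field,finite} option \<Rightarrow> ('a ^ 3) set set" where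
  "pencil_line s = {P \<in> proj_points. P \<subseteq> plane s}"

lemma independent_if_det_nonzero:
  fixes x y z :: "'a::field ^ 3"
  assumes "det (vector [x, y, z] :: 'a ^ 3 ^ 3) \<noteq> 0"
  shows "vec.independent {x, y, z}"
proof -
  have "rows (vector [x, y, z] :: 'a ^ 3 ^ 3) = {x, y, z}"
    unfolding rows_def row_def UNIV_3
    by (auto simp: vec_lambda_eta) (metis exhaust_3 vector_3)+
  then show ?thesis
    using det_dependent_rows assms by metis
qed

lemma det_vector_3:
  fixes x y z :: "'a::comm_ring_1 ^ 3"
  shows "det (vector [x, y, z] :: 'a ^ 3 ^ 3) =
    x$1 * y$2 * z$3 + x$2 * y$3 * z$1 + x$3 * y$1 * z$2
    - x$1 * y$3 * z$2 - x$2 * y$1 * z$3 - x$3 * y$2 * z$1"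
  by (simp add: det_3)

lemma det_vector_3_rotate:
  fixes x y z :: "'a::comm_ring_1 ^ 3"
  shows "det (vector [x, y, z] :: 'a ^ 3 ^ 3) = det (vector [y, z, x] :: 'a ^ 3 ^ 3)"
  by (simp add: det_vector_3 algebra_simps)

lemma rep_nth [simp]:
  "rep (Some c) w $ 1 = 1" "rep (Some c) w $ 2 = c" "rep s w $ 3 = w"
  "rep None w $ 1 = 0" "rep None w $ 2 = 1"
  by (auto simp: rep_def split: option.splits)

lemma vertex_nth [simp]: "vertex $ 1 = 0" "vertex $ 2 = 0" "vertex $ 3 = 1"
  by (auto simp: vertex_def)

lemma rep_nonzero: "rep s w \<noteq> 0"
  by (cases s) (metis rep_nth zero_index zero_neq_one)+

lemma vertex_nonzero: "vertex \<noteq> 0"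
  by (metis vertex_nth(3) zero_index zero_neq_one)

lemma span_in_proj_points: "x \<noteq> 0 \<Longrightarrow> vec.span {x} \<in> proj_points"
  by (simp add: proj_points_def vec.dim_eq_card_independent)

lemma span_subset_subspace_iff:
  "vec.subspace W \<Longrightarrow> vec.span {x} \<subseteq> W \<longleftrightarrow> x \<in> W"
  by (metis empty_subsetI insert_subset vec.span_base vec.span_minimal singletonI subsetD)

lemma span_rep_eq_iff [simp]:
  "vec.span {rep s w} = vec.span {rep s' w'} \<longleftrightarrow> s = s' \<and> w = w'"
proof
  assume "vec.span {rep s w} = vec.span {rep s' w'}"
  then have "rep s w \<in> vec.span {rep s' w'}"
    using vec.span_base by blast
  then obtain k where k: "rep s w = k *s rep s' w'"
    by (auto simp: vec.span_singleton)
  then have c: "rep s w $ i = k * rep s' w' $ i" for i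
    by simp
  show "s = s' \<and> w = w'"
    using c[of 1] c[of 2] c[of 3] by (cases s; cases s') auto
qed simp

lemma subspace_plane: "vec.subspace (plane s)"
  by (cases s) (auto simp: plane_def vec.subspace_def algebra_simps)

lemma vertex_in_plane: "vertex \<in> plane s"
  by (cases s) (auto simp: plane_def)

lemma rep_in_plane_iff [simp]: "rep s w \<in> plane s' \<longleftrightarrow> s = s'"
  by (cases s; cases s') (auto simp: plane_def)

lemma independent_rep_vertex: "vec.independent {rep s w, vertex}"
proof -
  \<comment> \<open>The two vectors are completed to a basis by a unit vector outside \<open>plane s\<close>.\<close>
  define y :: "'a ^ 3" where "y = (case s of None \<Rightarrow> vector [1, 0, 0] | Some c \<Rightarrow> vector [0, 1, 0])"
  have "det (vector [rep s w, vertex, y] :: 'a ^ 3 ^ 3) \<noteq> 0"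
    by (cases s) (auto simp: det_vector_3 y_def)
  then have "vec.independent {rep s w, vertex, y}"
    by (rule independent_if_det_nonzero)
  then show ?thesis
    by (rule vec.independent_mono) auto
qed

lemma rep_neq_vertex: "rep s w \<noteq> vertex"
  by (cases s) (metis rep_nth vertex_nth zero_neq_one)+

lemma dim_span_rep_vertex: "vec.dim (vec.span {rep s w, vertex}) = 2"
  using vec.dim_span_eq_card_independent[OF independent_rep_vertex[of s w]]
  by (simp add: rep_neq_vertex)

lemma plane_eq_span: "plane s = vec.span {rep s 0, vertex}"
proof
  show "vec.span {rep s 0, vertex} \<subseteq> plane s"
    by (rule vec.span_minimal) (auto simp: subspace_plane vertex_in_plane)
  show "plane s \<subseteq> vec.span {rep s 0, vertex}"
  proof
    fix x assume x: "x \<in> plane s"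
    define k where "k = (case s of None \<Rightarrow> x $ 2 | Some c \<Rightarrow> x $ 1)"
    have "x = k *s rep s 0 + (x $ 3) *s vertex"
      using x by (cases s) (auto simp: vec_eq_iff forall_3 plane_def k_def)
    also have "\<dots> \<in> vec.span {rep s 0, vertex}"
      by (intro vec.span_add vec.span_scale vec.span_base) auto
    finally show "x \<in> vec.span {rep s 0, vertex}" .
  qed
qed

lemma dim_plane: "vec.dim (plane s) = 2"
  by (simp only: plane_eq_span dim_span_rep_vertex)

lemma plane_cases:
  assumes W: "vec.subspace W" "vec.dim W = 2" "vertex \<in> W"
  obtains s where "W = plane s"
proof -
  have "\<not> W \<subseteq> vec.span {vertex}"
  proof
    assume "W \<subseteq> vec.span {vertex}"
    then have "vec.dim W \<le> vec.dim (vec.span {vertex::'a^3})"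
      by (rule vec.dim_subset)
    moreover have "vec.dim (vec.span {vertex::'a^3}) = 1"
      using span_in_proj_points[OF vertex_nonzero] by (simp add: proj_points_def)
    ultimately show False using W(2) by simp
  qed
  then obtain x where x: "x \<in> W" "x \<notin> vec.span {vertex}" by blast
  have nz: "x $ 1 \<noteq> 0 \<or> x $ 2 \<noteq> 0"
  proof (rule ccontr)
    assume "\<not> ?thesis"
    then have "x = (x $ 3) *s vertex"
      by (auto simp: vec_eq_iff forall_3)
    then show False using x(2) by (auto simp: vec.span_singleton)
  qed
  define s where "s = (if x $ 1 = 0 then None else Some (x $ 2 / x $ 1))"
  define k where "k = (if x $ 1 = 0 then x $ 2 else x $ 1)"
  have k: "k \<noteq> 0" using nz by (auto simp: k_def)
  have "rep s 0 = inverse k *s (x - (x $ 3) *s vertex)"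
    using nz by (auto simp: vec_eq_iff forall_3 s_def k_def field_simps)
  then have "rep s 0 \<in> W"
    using x(1) W(1,3) by (simp add: vec.subspace_scale vec.subspace_diff)
  then have "plane s \<subseteq> W"
    unfolding plane_eq_span by (intro vec.span_minimal) (auto simp: W)
  then have "plane s = W"
    by (intro vec.subspace_dim_equal) (auto simp: subspace_plane W dim_plane)
  then show ?thesis using that by blast
qed

lemma span_rep_in_pencil_line_iff [simp]:
  "vec.span {rep s w} \<in> pencil_line s' \<longleftrightarrow> s = s'"
  by (simp add: pencil_line_def span_in_proj_points rep_nonzero
      span_subset_subspace_iff subspace_plane)

lemma bij_betw_pencil_line:
  "bij_betw pencil_line UNIV {L \<in> proj_lines. vec.span {vertex} \<in> L}"
proof (rule bij_betwI')
  show "pencil_line s = pencil_line s' \<longleftrightarrow> s = s'" for s s' :: "'a option"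
    using span_rep_in_pencil_line_iff by blast
  show "pencil_line s \<in> {L \<in> proj_lines. vec.span {vertex} \<in> L}" for s :: "'a option"
  proof -
    have "pencil_line s \<in> proj_lines"
      unfolding pencil_line_def proj_lines_def using subspace_plane dim_plane by blast
    then show ?thesis
      by (auto simp: pencil_line_def span_in_proj_points vertex_nonzero
          span_subset_subspace_iff subspace_plane vertex_in_plane)
  qed
  show "\<exists>s\<in>UNIV. L = pencil_line s" if L: "L \<in> {L \<in> proj_lines. vec.span {vertex} \<in> L}"
    for L :: "('a ^ 3) set set"
  proof -
    obtain W where W: "vec.subspace W" "vec.dim W = 2" "L = {P \<in> proj_points. P \<subseteq> W}"
      using L by (auto simp: proj_lines_def)
    moreover have "vertex \<in> W"
      using L W by (auto simp: span_subset_subspace_iff)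
    ultimately show ?thesis
      by (metis UNIV_I pencil_line_def plane_cases)
  qed
qed

text \<open>
  Two points of a line through the vertex, other than the vertex, are independent together with
  any point off this line.
\<close>

lemma det_two_on_line_nonzero:
  fixes w :: "'a::{field,finite}"
  assumes "s \<noteq> s'" "w \<noteq> w'"
  shows "det (vector [rep s w, rep s w', rep s' w''] :: 'a ^ 3 ^ 3) \<noteq> 0"
proof -
  have "det (vector [rep s w, rep s w', rep s' w''] :: 'a ^ 3 ^ 3) =
    (w' - w) * (rep s 0 $ 2 * rep s' 0 $ 1 - rep s 0 $ 1 * rep s' 0 $ 2)"
    by (cases s; cases s') (simp_all add: det_vector_3 algebra_simps)
  moreover have "rep s 0 $ 2 * rep s' 0 $ 1 \<noteq> rep s 0 $ 1 * rep s' 0 $ 2"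
    using assms(1) by (cases s; cases s') auto
  ultimately show ?thesis using assms(2) by simp
qed

section \<open>Pencil arcs from sets of affine coordinates\<close>

lemma independent_points_span:
  assumes "inj_on (\<lambda>x. vec.span {x}) S" "vec.independent S"
  shows "independent_points ((\<lambda>x. vec.span {x}) ` S)"
proof -
  define p where "p x = vec.span {x}" for x :: "'a ^ 3"
  have inv: "inv_into S p (p x) = x" if "x \<in> S" for x
    using assms(1) that unfolding p_def by (rule inv_into_f_f)
  then have "inv_into S p ` p ` S = S"
    by (force simp: image_image)
  moreover have "\<forall>P\<in>p ` S. P = vec.span {inv_into S p P}"
    using inv by (auto simp: p_def)
  ultimately show ?thesis
    unfolding independent_points_def p_def[symmetric] using assms(2) by metis
qed

lemma independent_points_pair:
  assumes "T \<subseteq> proj_points" "card T = 2"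
  shows "independent_points T"
proof -
  obtain P Q where T: "T = {P, Q}" "P \<noteq> Q"
    using assms(2) by (auto simp: card_2_iff)
  have generator: "\<exists>x. x \<noteq> 0 \<and> R = vec.span {x}" if "R \<in> proj_points" for R :: "('a ^ 3) set"
  proof -
    have R: "vec.subspace R" "vec.dim R = 1" using that by (auto simp: proj_points_def)
    obtain B where B: "B \<subseteq> R" "vec.independent B" "R \<subseteq> vec.span B" "card B = 1"
      using vec.basis_exists[of R] R(2) by auto
    obtain x where x: "B = {x}" using B(4) by (auto simp: card_1_singleton_iff)
    have "vec.span B \<subseteq> R" using B(1) R(1) by (rule vec.span_minimal)
    then show ?thesis using B x by (auto intro!: exI[of _ x])
  qed
  obtain x where x: "x \<noteq> 0" "P = vec.span {x}" using generator[of P] assms(1) T by auto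
  obtain y where y: "y \<noteq> 0" "Q = vec.span {y}" using generator[of Q] assms(1) T by auto
  have "x \<notin> vec.span {y}"
  proof
    assume "x \<in> vec.span {y}"
    then have "P \<subseteq> Q" using x y by (simp add: span_subset_subspace_iff)
    then have "P = Q"
      using assms(1) T by (intro vec.subspace_dim_equal) (auto simp: proj_points_def)
    then show False using T by simp
  qed
  then have "vec.independent {x, y}"
    using y(1) by (simp add: vec.independent_insert)
  moreover have "inj_on (\<lambda>x. vec.span {x}) {x, y}"
    using T x y by auto
  ultimately show ?thesis
    using independent_points_span[of "{x, y}"] T x y by simp
qed

text \<open>
  A pencil has to be labelled so that the lines that meet the arc come first.
\<close>

lemma ex_bij_betw_initial_segment:
  assumes "finite A" "M \<subseteq> A" "card A = Suc n"
  obtains f where "bij_betw f {0..n} A" "f ` {..<card M} = M"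
proof -
  have fM: "finite M" using assms finite_subset by blast
  obtain g where g: "bij_betw g {0..<card M} M"
    using ex_bij_betw_nat_finite[OF fM] by blast
  have le: "card M \<le> Suc n" using card_mono[OF assms(1,2)] assms(3) by simp
  have "card {card M..n} = card (A - M)"
    using assms fM le by (simp add: card_Diff_subset)
  then obtain h where h: "bij_betw h {card M..n} (A - M)"
    using finite_same_card_bij[of "{card M..n}" "A - M"] assms(1) by auto
  define f where "f i = (if i \<in> {0..<card M} then g i else h i)" for i
  have "bij_betw f ({0..<card M} \<union> {card M..n}) (M \<union> (A - M))"
    unfolding f_def using g h by (intro bij_betw_disjoint_Un) auto
  moreover have "{0..<card M} \<union> {card M..n} = {0..n}" using le by auto
  moreover have "M \<union> (A - M) = A" using assms(2) by blast
  moreover have "f ` {..<card M} = M"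
    using g by (auto simp: f_def bij_betw_def lessThan_atLeast0)
  ultimately show ?thesis using that by simp
qed

text \<open>
  A pencil arc is described by the set \<open>D s\<close> of third coordinates of its points for every slope
  \<open>s\<close>. Only triples of points on three different lines of the pencil have to be checked.
\<close>

lemma regular_parcI:
  fixes D :: "'a::{field,finite} option \<Rightarrow> 'a set"
  assumes M: "card M = m"
    and D_in: "\<And>s. s \<in> M \<Longrightarrow> card (D s) = h"
    and D_out: "\<And>s. s \<notin> M \<Longrightarrow> D s = {}"
    and det: "\<And>s s' s'' w w' w''. \<lbrakk>w \<in> D s; w' \<in> D s'; w'' \<in> D s''; s \<noteq> s'; s' \<noteq> s''; s \<noteq> s''\<rbrakk> \<Longrightarrow>
      det (vector [rep s w, rep s' w', rep s'' w''] :: 'a ^ 3 ^ 3) \<noteq> 0"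
  shows "regular_parc m h {vec.span {rep s w} | s w. w \<in> D s}"
proof -
  define K where "K = {vec.span {rep s w} | s w. w \<in> D s}"
  have KP: "K \<subseteq> proj_points"
    by (auto simp: K_def span_in_proj_points rep_nonzero)
  have K_line: "K \<inter> pencil_line s = (\<lambda>w. vec.span {rep s w}) ` D s" for s
    by (auto simp: K_def)
  have card_K_line: "card (K \<inter> pencil_line s) = card (D s)" for s
    unfolding K_line by (rule card_image) (auto simp: inj_on_def)
  have M_le: "card M \<le> CARD('a) + 1"
    using card_mono[of "UNIV :: 'a option set" M] by (simp add: card_UNIV_option)
  obtain f where f: "bij_betw f {0..CARD('a)} (UNIV :: 'a option set)" "f ` {..<card M} = M"
    by (rule ex_bij_betw_initial_segment[of "UNIV :: 'a option set" M "CARD('a)"])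
      (auto simp: card_UNIV_option)
  define \<Psi> where "\<Psi> = pencil_line \<circ> f"
  have pencil: "bij_betw \<Psi> {0..CARD('a)} {L \<in> proj_lines. vec.span {vertex} \<in> L}"
    unfolding \<Psi>_def by (rule bij_betw_trans[OF f(1) bij_betw_pencil_line])
  have \<Psi>_line: "\<Psi> i \<in> proj_lines" if "i \<le> CARD('a)" for i
    using pencil that by (auto simp: bij_betw_def)
  have triple: "independent_points T"
    if T: "T \<subseteq> K" "card T = 3" "\<not> (\<exists>i\<le>CARD('a). T \<subseteq> \<Psi> i)" for T
  proof -
    obtain P Q R where PQR: "T = {P, Q, R}" "P \<noteq> Q" "Q \<noteq> R" "P \<noteq> R"
      using T(2) by (auto simp: card_3_iff)
    obtain s w where P: "P = vec.span {rep s w}" "w \<in> D s"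
      using PQR T(1) by (auto simp: K_def)
    obtain s' w' where Q: "Q = vec.span {rep s' w'}" "w' \<in> D s'"
      using PQR T(1) by (auto simp: K_def)
    obtain s'' w'' where R: "R = vec.span {rep s'' w''}" "w'' \<in> D s''"
      using PQR T(1) by (auto simp: K_def)
    have "\<not> (s = s' \<and> s' = s'')"
    proof
      assume "s = s' \<and> s' = s''"
      then have "T \<subseteq> pencil_line s"
        using PQR P Q R by auto
      moreover obtain i where "i \<le> CARD('a)" "f i = s"
        using f(1) unfolding bij_betw_def by (metis UNIV_I atLeastAtMost_iff imageE)
      ultimately show False
        using T(3) by (auto simp: \<Psi>_def)
    qed
    then consider "s \<noteq> s'" "s' \<noteq> s''" "s \<noteq> s''" | "s = s'" "s' \<noteq> s''" | "s = s''" "s \<noteq> s'"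
      | "s' = s''" "s \<noteq> s'"
      by blast
    then have "det (vector [rep s w, rep s' w', rep s'' w''] :: 'a ^ 3 ^ 3) \<noteq> 0"
    proof cases
      case 1
      then show ?thesis using det P Q R by blast
    next
      case 2
      then show ?thesis using det_two_on_line_nonzero[of s s'' w w' w''] PQR P Q by auto
    next
      case 3
      then show ?thesis
        unfolding det_vector_3_rotate[of "rep s'' w''", symmetric]
        using det_two_on_line_nonzero[of s s' w'' w w'] PQR P R by auto
    next
      case 4
      then show ?thesis
        unfolding det_vector_3_rotate[of "rep s w"]
        using det_two_on_line_nonzero[of s' s w' w'' w] PQR Q R by auto
    qed
    then have "vec.independent {rep s w, rep s' w', rep s'' w''}"
      by (rule independent_if_det_nonzero)
    moreover have "inj_on (\<lambda>x. vec.span {x}) {rep s w, rep s' w', rep s'' w''}"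
      by (auto simp: inj_on_def)
    ultimately show ?thesis
      using independent_points_span[of "{rep s w, rep s' w', rep s'' w''}"] PQR P Q R by simp
  qed
  have "parc (card K) \<Psi> K"
    unfolding parc_def
  proof (intro conjI allI impI)
    show "labelled_pencil \<Psi>"
      unfolding labelled_pencil_def using pencil span_in_proj_points[OF vertex_nonzero] by blast
    show "line_arc (card (K \<inter> \<Psi> i)) (\<Psi> i) (K \<inter> \<Psi> i)" if "i \<le> CARD('a)" for i
      unfolding line_arc_def using \<Psi>_line[OF that] KP independent_points_pair by blast
    show "K \<inter> \<Psi> i \<inter> \<Psi> j = {}" if "i \<le> CARD('a)" "j \<le> CARD('a)" "i \<noteq> j" for i j
    proof -
      have "f i \<noteq> f j" using f(1) that by (auto simp: bij_betw_def inj_on_def)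
      then show ?thesis by (auto simp: \<Psi>_def K_line)
    qed
  qed (use KP triple in auto)
  moreover have "card (K \<inter> \<Psi> i) = h" if "i < m" for i
    using f(2) M that D_in by (auto simp: \<Psi>_def card_K_line)
  moreover have "card (K \<inter> \<Psi> i) = 0" if "i \<in> {m..CARD('a)}" for i
  proof -
    have "f i \<notin> M"
    proof
      assume "f i \<in> M"
      then obtain j where "j < m" "f j = f i" using f(2) M by (metis imageE lessThan_iff)
      moreover have "j \<in> {0..CARD('a)}" "i \<in> {0..CARD('a)}" using \<open>j < m\<close> that by auto
      ultimately have "j = i" using f(1) by (metis bij_betw_def inj_onD)
      then show False using \<open>j < m\<close> that by simp
    qed
    then show ?thesis by (simp add: \<Psi>_def card_K_line D_out)
  qed
  ultimately show ?thesis
    unfolding regular_parc_def K_def[symmetric] using M M_le by (metis Suc_eq_plus1)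
qed

section \<open>The trace onto the subfield\<close>

lemma power_CARD_eq_same:
  fixes x :: "'a::{field,finite}"
  shows "x ^ CARD('a) = x"
proof (cases "x = 0")
  case False
  have "\<Prod>(UNIV - {0}) = (\<Prod>y\<in>UNIV - {0}. x * y)"
    by (rule prod.reindex_bij_witness[of _ "\<lambda>y. x * y" "\<lambda>y. y / x"]) (use False in auto)
  also have "\<dots> = x ^ (CARD('a) - 1) * \<Prod>(UNIV - {0})"
    by (simp add: prod.distrib card_Diff_subset)
  finally have "x ^ (CARD('a) - 1) = 1"
    by simp
  then show ?thesis
    using power_Suc[of x "CARD('a) - 1"] by simp
qed simp

text \<open>
  A field with \<open>q\<^sup>2\<close> elements, where \<open>q\<close> is an even prime power. The argument of type \<open>'a itself\<close> only
  serves to name the field.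
\<close>

locale square_field =
  fixes q :: nat and dummy :: "'a::{field,finite} itself"
  assumes even_q: "even q" and primepow_q: "primepow q" and card_field: "CARD('a) = q ^ 2"
begin

text \<open>The subfield with \<open>q\<close> elements.\<close>

definition base :: "'a set" where "base = {x. x ^ q = x}"

text \<open>The trace onto \<open>base\<close>.\<close>

definition tr :: "'a \<Rightarrow> 'a" where "tr x = x ^ q + x"

text \<open>The characteristic is two because \<open>-1 = (-1) ^ CARD('a) = 1\<close>.\<close>

lemma add_self [simp]: "x + x = (0 :: 'a)"
proof -
  have "(-1 :: 'a) ^ CARD('a) = 1"
    using even_q by (simp add: card_field)
  then have "(1 :: 'a) + 1 = 0"
    using power_CARD_eq_same[of "-1 :: 'a"] by (metis add.right_inverse)
  then show ?thesis
    by (metis distrib_left mult.right_neutral mult_zero_right)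
qed

lemma q_gt_1: "q > 1"
  using primepow_gt_Suc_0[OF primepow_q] by simp

lemma add_power_q: "(x + y :: 'a) ^ q = x ^ q + y ^ q"
proof -
  have "CHAR('a) dvd 2"
    by (metis add_self of_nat_1 of_nat_add of_nat_eq_0_iff_char_dvd one_add_one)
  then have char: "CHAR('a) = 2"
    using CHAR_not_1' two_is_prime_nat by (metis prime_nat_iff One_nat_def)
  obtain p k where "prime p" "q = p ^ k"
    using primepow_q by (auto simp: primepow_def)
  then have "q = 2 ^ k"
    using even_q by (metis prime_dvd_power primes_dvd_imp_eq two_is_prime_nat)
  then show ?thesis
    by (intro freshmans_dream') (simp_all add: char)
qed

lemma base_add: "x \<in> base \<Longrightarrow> y \<in> base \<Longrightarrow> x + y \<in> base"
  by (simp add: base_def add_power_q)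

lemma base_mult: "x \<in> base \<Longrightarrow> y \<in> base \<Longrightarrow> x * y \<in> base"
  by (simp add: base_def power_mult_distrib)

lemma base_01: "0 \<in> base" "1 \<in> base"
  using q_gt_1 by (simp_all add: base_def)

lemma tr_in_base: "tr x \<in> base"
proof -
  have "(x ^ q) ^ q = x"
    using power_CARD_eq_same[of x] by (simp add: card_field power2_eq_square power_mult)
  then show ?thesis
    by (simp add: base_def tr_def add_power_q add.commute)
qed

lemma tr_add: "tr (x + y) = tr x + tr y"
  by (simp add: tr_def add_power_q add_ac)

lemma tr_mult: "c \<in> base \<Longrightarrow> tr (c * x) = c * tr x"
  by (simp add: tr_def base_def power_mult_distrib distrib_left)

lemma card_tr_fibre_le: "card {x. tr x = c} \<le> q"
proof -
  define p :: "'a Polynomial.poly" where "p = Polynomial.monom 1 q + [:- c, 1:]"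
  have deg: "degree p = q"
    unfolding p_def using q_gt_1
    by (subst degree_add_eq_left) (simp_all add: degree_monom_eq)
  then have "p \<noteq> 0" using q_gt_1 by auto
  have "{x. tr x = c} = {x. poly p x = 0}"
    by (auto simp: p_def tr_def poly_monom algebra_simps eq_neg_iff_add_eq_0)
  then show ?thesis
    using card_poly_roots_bound[OF \<open>p \<noteq> 0\<close>] deg by simp
qed

text \<open>
  The kernel of the trace is \<open>base\<close>. So at most \<open>q\<close> fibres with at most \<open>q\<close> elements each cover
  the \<open>q\<^sup>2\<close> elements of the field, and equality holds everywhere.
\<close>

lemma card_base_and_tr_fibre:
  shows card_base: "card base = q"
    and card_tr_fibre: "c \<in> base \<Longrightarrow> card {x. tr x = c} = q"
proof -
  have "base = {x. tr x = 0}"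
    by (auto simp: base_def tr_def) (metis add_self add_right_cancel)+
  then have le: "card base \<le> q"
    using card_tr_fibre_le by simp
  have sum: "(\<Sum>c\<in>base. card {x. tr x = c}) = q * q"
  proof -
    have "UNIV = (\<Union>c\<in>base. {x. tr x = c})"
      using tr_in_base by auto
    then have "CARD('a) = card (\<Union>c\<in>base. {x. tr x = c})"
      by simp
    also have "\<dots> = (\<Sum>c\<in>base. card {x. tr x = c})"
      by (rule card_UN_disjoint) auto
    finally show ?thesis by (simp add: card_field power2_eq_square)
  qed
  have "q * q \<le> card base * q"
    unfolding sum[symmetric] using card_tr_fibre_le sum_bounded_above[of base _ q] by simp
  then show base: "card base = q"
    using le q_gt_1 by simp
  show "card {x. tr x = c} = q" if "c \<in> base"
  proof (rule ccontr)
    assume "card {x. tr x = c} \<noteq> q"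
    then have "card {x. tr x = c} < q"
      using card_tr_fibre_le le_neq_implies_less by blast
    then have "(\<Sum>c\<in>base. card {x. tr x = c}) < (\<Sum>c\<in>base. q)"
      using that card_tr_fibre_le by (intro sum_strict_mono_ex1) auto
    then show False using sum base by simp
  qed
qed

lemma tr_diff: "tr (x - y) = tr x - tr y"
  by (metis add_diff_cancel_right' diff_add_cancel tr_add)

lemma tr_0: "tr 0 = 0"
  using tr_diff[of 0 0] by simp

lemma card_tr_vimage:
  assumes "S \<subseteq> base"
  shows "card {w. tr w \<in> S} = card S * q"
proof -
  have "{w. tr w \<in> S} = (\<Union>c\<in>S. {w. tr w = c})" by auto
  also have "card \<dots> = (\<Sum>c\<in>S. card {w. tr w = c})"
    by (rule card_UN_disjoint) auto
  also have "\<dots> = (\<Sum>c\<in>S. q)"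
    using assms by (intro sum.cong) (auto intro: card_tr_fibre)
  finally show ?thesis by simp
qed

section \<open>The two pencil arcs\<close>

text \<open>
  The slope of the line through the vertex and the point \<open>(1, t\<^sup>2 + e * t, t)\<close> of the arc over \<open>base\<close>.
\<close>

definition slope :: "'a \<Rightarrow> 'a \<Rightarrow> 'a" where "slope e t = t\<^sup>2 + e * t"

text \<open>
  The third coordinates of the points of the pencil arc on the line with slope \<open>s\<close>. A point
  \<open>(1, c, w)\<close> belongs to it if \<open>(1, c, tr w)\<close> is \<open>(1, t\<^sup>2 + e * t, t)\<close> for \<open>t = tr w\<close>, and a point
  \<open>(0, 1, w)\<close> if \<open>(0, 1, tr w)\<close> is \<open>(0, 1, 0)\<close> or \<open>(0, 1, e)\<close>.
\<close>

definition slice :: "'a \<Rightarrow> 'a option \<Rightarrow> 'a set" where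
  "slice e s = (case s of None \<Rightarrow> {w. tr w \<in> {0, e}} | Some c \<Rightarrow> {w. slope e (tr w) = c})"

lemma slope_in_base: "e \<in> base \<Longrightarrow> t \<in> base \<Longrightarrow> slope e t \<in> base"
  by (simp add: slope_def power2_eq_square base_add base_mult)

lemma eq_iff_add_eq_0: "x = y \<longleftrightarrow> x + y = (0 :: 'a)"
  by (metis add_self add_left_cancel)

text \<open>
  For \<open>e = 0\<close> every line through the vertex with a given slope has one point of the arc over
  \<open>base\<close> at most; for \<open>e \<noteq> 0\<close> such points come in pairs.
\<close>

lemma slope_eq_iff: "slope e t = slope e u \<longleftrightarrow> t \<in> {u, u + e}"
proof -
  have "slope e t + slope e u = (t + u) * (t + (u + e)) - (t * u + t * u)"
    by (simp add: slope_def algebra_simps power2_eq_square del: add_self)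
  also have "\<dots> = (t + u) * (t + (u + e))"
    by (simp only: add_self diff_zero)
  finally show ?thesis
    using eq_iff_add_eq_0 by (metis insert_iff mult_eq_0_iff singletonD)
qed

lemma card_translate: "card {t, t + e} = card {0, e :: 'a}"
  by (cases "e = 0") auto

lemma card_slope_image:
  assumes "e \<in> base"
  shows "card (slope e ` base) * card {0, e} = q"
proof -
  have "card {t \<in> base. slope e t = c} = card {0, e}" if c: "c \<in> slope e ` base" for c
  proof -
    obtain u where u: "u \<in> base" "c = slope e u" using c by blast
    then have "{t \<in> base. slope e t = c} = {u, u + e}"
      using assms base_add by (auto simp: slope_eq_iff)
    then show ?thesis by (simp only: card_translate)
  qed
  then have "(\<Sum>c\<in>slope e ` base. card {t \<in> base. slope e t = c}) =
      card (slope e ` base) * card {0, e}"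
    by simp
  moreover have "card base = (\<Sum>c\<in>slope e ` base. card {t \<in> base. slope e t = c})"
    using sum.image_gen[of base "\<lambda>_. 1 :: nat" "slope e"] by simp
  ultimately show ?thesis using card_base by simp
qed

lemma card_slice:
  assumes e: "e \<in> base" and s: "s \<in> insert None (Some ` slope e ` base)"
  shows "card (slice e s) = card {0, e} * q"
proof (cases s)
  case None
  then show ?thesis
    using card_tr_vimage[of "{0, e}"] e base_01 by (simp add: slice_def)
next
  case (Some c)
  then obtain u where u: "u \<in> base" "c = slope e u" using s by blast
  then have "slice e s = {w. tr w \<in> {u, u + e}}"
    using Some by (simp add: slice_def slope_eq_iff)
  moreover have "{u, u + e} \<subseteq> base" using e u base_add by simp
  ultimately show ?thesis by (simp only: card_tr_vimage card_translate)
qed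

lemma slice_empty:
  assumes "s \<notin> insert None (Some ` slope e ` base)"
  shows "slice e s = {}"
  using assms tr_in_base by (cases s) (auto simp: slice_def)

lemma det_affine_nonzero:
  assumes e: "e \<in> base"
    and w: "w \<in> slice e (Some c)" "w' \<in> slice e (Some c')" "w'' \<in> slice e (Some c'')"
    and c: "c \<noteq> c'" "c' \<noteq> c''" "c \<noteq> c''"
  shows "det (vector [rep (Some c) w, rep (Some c') w', rep (Some c'') w''] :: 'a ^ 3 ^ 3) \<noteq> 0"
    (is "?d \<noteq> 0")
proof -
  define t t' t'' where t: "t = tr w" "t' = tr w'" "t'' = tr w''"
  have c_eq: "c = slope e t" "c' = slope e t'" "c'' = slope e t''"
    using w by (auto simp: slice_def t)
  have base: "c \<in> base" "c' \<in> base" "c'' \<in> base"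
    using e by (auto simp: c_eq t slope_in_base tr_in_base)
  have "?d = c' * w'' + c * w' + c'' * w - c'' * w' - c * w'' - c' * w"
    by (simp add: det_vector_3 algebra_simps)
  then have "tr ?d = c' * t'' + c * t' + c'' * t - c'' * t' - c * t'' - c' * t"
    using base by (simp add: tr_add tr_diff tr_mult t)
  \<comment> \<open>The terms with \<open>e\<close> cancel, and a Vandermonde determinant remains.\<close>
  also have "\<dots> = (t' - t) * (t'' - t) * (t' - t'')"
    by (simp add: c_eq slope_def algebra_simps power2_eq_square)
  also have "\<dots> \<noteq> 0"
    using c c_eq by auto
  finally show ?thesis using tr_0 by auto
qed

lemma det_infinite_nonzero:
  assumes e: "e \<in> {0, 1}"
    and w: "w \<in> slice e None" "w' \<in> slice e (Some c')" "w'' \<in> slice e (Some c'')"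
    and c: "c' \<noteq> c''"
  shows "det (vector [rep None w, rep (Some c') w', rep (Some c'') w''] :: 'a ^ 3 ^ 3) \<noteq> 0"
    (is "?d \<noteq> 0")
proof -
  define t t' t'' where t: "t = tr w" "t' = tr w'" "t'' = tr w''"
  have c_eq: "c' = slope e t'" "c'' = slope e t''"
    using w by (auto simp: slice_def t)
  have t01: "t \<in> {0, e}" using w(1) by (simp add: slice_def t)
  have base: "c' \<in> base" "c'' \<in> base"
    using e by (auto simp: c_eq t intro!: slope_in_base tr_in_base base_01)
  have "?d = w' - w'' + c'' * w - c' * w"
    by (simp add: det_vector_3 algebra_simps)
  then have "tr ?d = t' - t'' + c'' * t - c' * t"
    using base by (simp add: tr_add tr_diff tr_mult t)
  also have "\<dots> = (t' - t'') * (1 - t * (t' + t'' + e))"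
    by (simp add: c_eq slope_def algebra_simps power2_eq_square)
  also have "\<dots> \<noteq> 0"
  proof -
    have ne: "t' \<noteq> t''" using c c_eq by auto
    then have "t' + t'' \<noteq> 0" using eq_iff_add_eq_0 by blast
    \<comment> \<open>The product vanishes unless \<open>t = e = 1\<close>, and then the difference is \<open>- (t' + t'')\<close>.\<close>
    then have "1 - t * (t' + t'' + e) \<noteq> 0"
      using t01 e by auto
    then show ?thesis using ne by simp
  qed
  finally show ?thesis using tr_0 by auto
qed

lemma regular_parc_slice:
  assumes e: "e \<in> {0, 1}"
  shows "regular_parc (q div card {0, e} + 1) (card {0, e} * q)
    {vec.span {rep s w} | s w. w \<in> slice e s}"
proof (rule regular_parcI)
  have eb: "e \<in> base" using e base_01 by auto
  have "card (slope e ` base) = q div card {0, e}"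
    using card_slope_image[OF eb]
    by (metis card_gt_0_iff finite.emptyI finite.insertI insert_not_empty
        nonzero_mult_div_cancel_right not_gr_zero)
  then show "card (insert None (Some ` slope e ` base)) = q div card {0, e} + 1"
    by (subst card_insert_disjoint) (auto simp: card_image)
  show "card (slice e s) = card {0, e} * q" if "s \<in> insert None (Some ` slope e ` base)" for s
    using card_slice[OF eb that] .
  show "slice e s = {}" if "s \<notin> insert None (Some ` slope e ` base)" for s
    using slice_empty[OF that] .
  show "det (vector [rep s w, rep s' w', rep s'' w''] :: 'a ^ 3 ^ 3) \<noteq> 0"
    if w: "w \<in> slice e s" "w' \<in> slice e s'" "w'' \<in> slice e s''"
      and s: "s \<noteq> s'" "s' \<noteq> s''" "s \<noteq> s''" for s s' s'' w w' w''
  proof -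
    consider c c' c'' where "s = Some c" "s' = Some c'" "s'' = Some c''"
      | c' c'' where "s = None" "s' = Some c'" "s'' = Some c''"
      | c c'' where "s = Some c" "s' = None" "s'' = Some c''"
      | c c' where "s = Some c" "s' = Some c'" "s'' = None"
      using s by (cases s; cases s'; cases s'') auto
    then show ?thesis
    proof cases
      case 1
      then show ?thesis using det_affine_nonzero[OF eb] w s by blast
    next
      case 2
      then show ?thesis using det_infinite_nonzero[OF e] w s by blast
    next
      case 3
      then show ?thesis
        unfolding det_vector_3_rotate[of "rep s w"] using det_infinite_nonzero[OF e] w s by blast
    next
      case 4
      then show ?thesis
        unfolding det_vector_3_rotate[of "rep s'' w''", symmetric]
        using det_infinite_nonzero[OF e] w s by blast
    qed
  qed
qed

end

theorem theorem5p3: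
  fixes q :: nat
  assumes "even q" and "primepow q"
    and "CARD('a::{field,finite}) = q ^ 2"
  shows "(\<exists>K :: ('a ^ 3) set set. regular_parc (q + 1) q K) \<and>
         (\<exists>K :: ('a ^ 3) set set. regular_parc ((q + 2) div 2) (2 * q) K)"
proof -
  interpret square_field q "TYPE('a)"
    using assms by unfold_locales
  have "regular_parc (q + 1) q {vec.span {rep s w} | s w. w \<in> slice 0 s}"
    using regular_parc_slice[of 0] by simp
  moreover have "regular_parc ((q + 2) div 2) (2 * q) {vec.span {rep s w} | s w. w \<in> slice 1 s}"
  proof -
    have "card {0, 1 :: 'a} = 2" by simp
    moreover have "(q + 2) div 2 = q div 2 + 1" by simp
    ultimately show ?thesis using regular_parc_slice[of 1] by (simp only: insert_iff simp_thms)
  qed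
  ultimately show ?thesis by blast
qed

end
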